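(* Let $\mathcal{U},\mathcal{Y}$ be Hilbert spaces and let $T:\mathcal{U}\to\mathcal{Y}$ be linear, bounded and injective. Let $\{u_i\}_{i=1}^\infty$ be a Riesz basis for $\mathcal{U}$ with frame operator $S:\mathcal{U}\to\mathcal{U}$, put $y_i:=Tu_i$ and $\mathcal{Y}_n:=\operatorname{span}\{y_1,\dots,y_n\}$, and let $P_{\mathcal{Y}_n}$ be the orthogonal projection of $\mathcal{Y}$ onto $\mathcal{Y}_n$. Let $u^\dagger\in\mathcal{U}$ and $y:=Tu^\dagger$. For all $i,n\in\mathbb{N}$ let $(c^{i,n}_j)_{j=1}^\infty$ be the unique sequence of scalars with $$T^{-1}P_{\mathcal{Y}_n}y_i=\sum_{j=1}^\infty c^{i,n}_j u_j .$$ Assume that $(\langle u^\dagger,S^{-1}u_i\rangle)_{i=1}^\infty\in \ell^1$ and that there is a constant $C$, independent of $i$ and $n$, such that $\sum_{j=1}^\infty |c^{i,n}_j|^2<C$ for every $i$ and $n$. Then the sequence $$\widetilde{u}_n^{\mathcal{U}}:=T^{-1}P_{\mathcal{Y}_n}y=\sum_{i=1}^\infty\langle u^\dagger,S^{-1}u_i\rangle\, T^{-1}P_{\mathcal{Y}_n}y_i,\qquad n\in\mathbb{N},$$ converges weakly to $u^\dagger$ in $\mathcal{U}$ as $n\to\infty$.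
   Context: A Riesz basis for a Hilbert space $H$ is a family $\{f_i\}_{i=1}^\infty=\{Le_i\}_{i=1}^\infty$, where $\{e_i\}_{i=1}^\infty$ is an orthonormal basis of $H$ and $L:H\to H$ is a bounded bijective linear operator. Every $f\in H$ has a unique expansion $f=\sum_{i=1}^\infty c_if_i$ with $\sum_i|c_i|^2<\infty$. The frame operator of $\{f_i\}$ is $S:H\to H$, $Sf=\sum_{i=1}^\infty\langle f,f_i\rangle f_i$; it is bounded, self-adjoint, positive and invertible, and $f=\sum_{i=1}^\infty\langle f,S^{-1}f_i\rangle f_i$ for all $f\in H$. $T^{-1}$ denotes the inverse of the injective operator $T$ on its range $R(T)$; since $\mathcal{Y}_n\subset R(T)$, $T^{-1}P_{\mathcal{Y}_n}$ is defined on all of $\mathcal{Y}$. *)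

theory Defs
  imports "HOL-Analysis.Analysis"
begin

text \<open>
  Scalar fields. The library's inner product spaces are real only, so the scalar field is
  abstracted to treat real and complex Hilbert spaces at once. For every \<open>x\<close> the axioms make both
  \<open>x * sconj x\<close> and \<open>x + sconj x\<close> real (for the latter, expand \<open>(1 + x) * sconj (1 + x)\<close>), so each
  scalar is quadratic over the reals; hence up to isomorphism the only instances are the reals with
  the identity and the complex numbers with complex conjugation.
\<close>

class rc_field = real_normed_field +
  fixes sconj :: "'a \<Rightarrow> 'a"
  assumes sconj_add: "sconj (x + y) = sconj x + sconj y"
    and sconj_mult: "sconj (x * y) = sconj x * sconj y"
    and mult_sconj: "x * sconj x = (norm x)\<^sup>2 *\<^sub>R 1"

instantiation real :: rc_field
begin
definition sconj_real :: "real \<Rightarrow> real" where "sconj_real x = x"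
instance by standard (simp_all add: sconj_real_def power2_eq_square)
end

instantiation complex :: rc_field
begin
definition sconj_complex :: "complex \<Rightarrow> complex" where "sconj_complex = cnj"
instance by standard
  (simp_all add: sconj_complex_def scaleR_conv_of_real complex_norm_square del: of_real_power)
end

text \<open>
  A Hilbert space is a Banach space whose norm comes from an inner product, linear in the first
  argument. Completeness is part of the class \<open>banach\<close>; positive definiteness of \<open>ip\<close> follows from
  \<open>ip_norm\<close>.
\<close>

locale hilbert_space = vector_space smul
  for smul :: "'k::rc_field \<Rightarrow> 'a::banach \<Rightarrow> 'a" +
  fixes ip :: "'a \<Rightarrow> 'a \<Rightarrow> 'k"
  assumes smul_of_real: "smul (of_real r) x = r *\<^sub>R x"
    and ip_add_left: "ip (x + y) z = ip x z + ip y z"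
    and ip_smul_left: "ip (smul a x) y = a * ip x y"
    and ip_commute: "ip x y = sconj (ip y x)"
    and ip_norm: "ip x x = of_real ((norm x)\<^sup>2)"

lemma hilbert_space_real:
  "hilbert_space scaleR (inner :: 'a::{real_inner,banach} \<Rightarrow> 'a \<Rightarrow> real)"
  by unfold_locales
    (simp_all add: sconj_real_def inner_commute inner_add_left algebra_simps
      dot_square_norm)

lemma hilbert_space_complex:
  "hilbert_space (*) (\<lambda>z w :: complex. z * cnj w)"
  by unfold_locales
    (simp_all add: sconj_complex_def algebra_simps scaleR_conv_of_real complex_norm_square
      del: of_real_power)

definition bounded_operator ::
  "('k::rc_field \<Rightarrow> 'a::banach \<Rightarrow> 'a) \<Rightarrow> ('k \<Rightarrow> 'b::banach \<Rightarrow> 'b) \<Rightarrow> ('a \<Rightarrow> 'b) \<Rightarrow> bool"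
where
  "bounded_operator sA sB T \<longleftrightarrow>
     Vector_Spaces.linear sA sB T \<and> (\<exists>K. \<forall>x. norm (T x) \<le> K * norm x)"

text \<open>
  Families are indexed from \<open>0\<close>: index \<open>i\<close> here is index \<open>i + 1\<close> in the usual notation, so the span of
  the first \<open>n\<close> members for \<open>n \<ge> 1\<close> is the span of the image of \<open>{..n - 1}\<close>.
\<close>

definition orthonormal_basis ::
  "('k::rc_field \<Rightarrow> 'a::banach \<Rightarrow> 'a) \<Rightarrow> ('a \<Rightarrow> 'a \<Rightarrow> 'k) \<Rightarrow> (nat \<Rightarrow> 'a) \<Rightarrow> bool"
where
  "orthonormal_basis smul ip e \<longleftrightarrow>
     (\<forall>i j. ip (e i) (e j) = (if i = j then 1 else 0)) \<and>
     closure (module.span smul (range e)) = UNIV"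

definition riesz_basis ::
  "('k::rc_field \<Rightarrow> 'a::banach \<Rightarrow> 'a) \<Rightarrow> ('a \<Rightarrow> 'a \<Rightarrow> 'k) \<Rightarrow> (nat \<Rightarrow> 'a) \<Rightarrow> bool"
where
  "riesz_basis smul ip f \<longleftrightarrow>
     (\<exists>e L. orthonormal_basis smul ip e \<and> bounded_operator smul smul L \<and> bij L \<and>
            (\<forall>i. f i = L (e i)))"

definition frame_operator ::
  "('k::rc_field \<Rightarrow> 'a::banach \<Rightarrow> 'a) \<Rightarrow> ('a \<Rightarrow> 'a \<Rightarrow> 'k) \<Rightarrow> (nat \<Rightarrow> 'a) \<Rightarrow> 'a \<Rightarrow> 'a"
where
  "frame_operator smul ip f x = (\<Sum>i. smul (ip x (f i)) (f i))"

text \<open>Well defined whenever \<open>V\<close> is a closed subspace, in particular if it is finite-dimensional.\<close>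

definition orth_proj :: "('a::banach \<Rightarrow> 'a \<Rightarrow> 'k::rc_field) \<Rightarrow> 'a set \<Rightarrow> 'a \<Rightarrow> 'a"
where
  "orth_proj ip V x = (THE p. p \<in> V \<and> (\<forall>v\<in>V. ip (x - p) v = 0))"

definition weakly_converges_to ::
  "('a::banach \<Rightarrow> 'a \<Rightarrow> 'k::rc_field) \<Rightarrow> (nat \<Rightarrow> 'a) \<Rightarrow> 'a \<Rightarrow> bool"
where
  "weakly_converges_to ip x l \<longleftrightarrow> (\<forall>v. (\<lambda>n. ip (x n) v) \<longlonglongrightarrow> ip l v)"

end

theory Submission
  imports Defs
begin

text \<open>
  Write \<open>a i = ipU u_dag (inv S (u i))\<close> and \<open>t n i = inv T (P n (y i))\<close>. The
  reconstruction formula \<open>u_dag = \<Sum>i. a i u i\<close> (\<open>riesz_basis_reconstruction\<close>) is mapped by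
  \<open>T\<close> and \<open>P n\<close> to \<open>P n y_dag = \<Sum>i. a i P n (y i)\<close>. The bound on the coefficients of \<open>t n i\<close>
  is a bound \<open>M\<close> on its norm (\<open>riesz_basis_upper_bound\<close>), so \<open>\<Sum>i. a i t n i\<close> converges
  absolutely; \<open>T\<close> maps its sum to \<open>P n y_dag\<close>, and injectivity of \<open>T\<close> identifies the sum with
  \<open>w n = inv T (P n y_dag)\<close>. In this way the possibly unbounded inverse of \<open>T\<close> is exchanged
  with the series.

  For \<open>i \<le> n\<close> the projection fixes \<open>y i\<close>, hence \<open>t n i = u i\<close>, and the first \<open>n + 1\<close> terms of
  \<open>w n - u_dag = \<Sum>i. a i (t n i - u i)\<close> vanish. The others are at most \<open>2 * M\<close> times \<open>norm (a i)\<close>,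
  so the error is bounded by a tail of an \<open>\<ell>\<^sup>1\<close> series. The convergence is therefore
  even in norm, and weak convergence follows.

  For the reconstruction formula, write \<open>u i = L (e i)\<close> with an orthonormal basis \<open>e\<close>. Then
  \<open>S = L L'\<close> with \<open>L'\<close> the adjoint of \<open>L\<close>, and \<open>inv S (u i)\<close> is the adjoint of \<open>inv L\<close> at \<open>e i\<close>, so
  \<open>a i\<close> is the \<open>i\<close>-th Fourier coefficient of \<open>inv L u_dag\<close>. This adjoint exists because \<open>inv L\<close>
  is bounded, which is the bounded inverse theorem (\<open>bounded_linear_inv\<close>).
\<close>

section \<open>The bounded inverse theorem\<close>

text \<open>
  Successive approximation: each step leaves a residual of at most half the norm, so the
  corrections are dominated by a geometric series. Their sum exists because the domain is complete.
\<close>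

lemma approx_preimage_imp_preimage:
  fixes L :: "'a::banach \<Rightarrow> 'b::real_normed_vector"
  assumes L: "bounded_linear L"
    and approx: "\<And>z. \<exists>x. norm x \<le> K * norm z \<and> norm (z - L x) \<le> norm z / 2"
  shows "\<exists>x. L x = z \<and> norm x \<le> 2 * K * norm z"
proof -
  interpret L: bounded_linear L by fact
  obtain g where g: "\<And>z. norm (g z) \<le> K * norm z" "\<And>z. norm (z - L (g z)) \<le> norm z / 2"
    using approx by metis
  \<comment> \<open>The residual after \<open>k\<close> corrections.\<close>
  define r where "r k = ((\<lambda>w. w - L (g w)) ^^ k) z" for k
  have r_Suc: "r (Suc k) = r k - L (g (r k))" for k
    by (simp add: r_def)
  have norm_r: "norm (r k) \<le> norm z * (1/2) ^ k" for k
  proof (induction k)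
    case (Suc k)
    have "norm (r (Suc k)) \<le> norm (r k) / 2"
      unfolding r_Suc by (rule g)
    with Suc show ?case by simp
  qed (simp add: r_def)
  have K: "K * norm z \<ge> 0"
    using g(1)[of z] norm_ge_zero order_trans by blast
  have norm_g: "norm (g (r k)) \<le> K * norm z * (1/2) ^ k" for k
  proof (cases "z = 0")
    case True
    then have "r k = 0" using norm_r[of k] by simp
    then show ?thesis using g(1)[of 0] True by simp
  next
    case False
    then have "K \<ge> 0" using K by (simp add: zero_le_mult_iff)
    then show ?thesis
      using g(1)[of "r k"] mult_left_mono[OF norm_r[of k], of K] by (simp add: mult_ac)
  qed
  have geo: "(\<lambda>k. K * norm z * (1/2) ^ k) sums (K * norm z * 2)"
    using sums_mult[OF geometric_sums[of "1/2 :: real"], of "K * norm z"] by simp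
  have summ: "summable (\<lambda>k. g (r k))"
    by (rule summable_comparison_test'[OF sums_summable[OF geo], of 0]) (rule norm_g)
  have part: "(\<Sum>k<n. L (g (r k))) = z - r n" for n
    by (induction n) (simp_all add: r_Suc, simp add: r_def)
  have "r \<longlonglongrightarrow> 0"
  proof (rule Lim_null_comparison)
    show "\<forall>\<^sub>F k in sequentially. norm (r k) \<le> norm z * (1/2) ^ k"
      using norm_r by simp
    show "(\<lambda>k. norm z * (1/2) ^ k) \<longlonglongrightarrow> 0"
      by (intro tendsto_mult_right_zero LIMSEQ_realpow_zero) auto
  qed
  then have "(\<lambda>k. L (g (r k))) sums z"
    unfolding sums_def part using tendsto_diff[OF tendsto_const] by fastforce
  moreover have "(\<lambda>k. L (g (r k))) sums L (\<Sum>k. g (r k))"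
    by (rule L.sums[OF summable_sums[OF summ]])
  ultimately have "L (\<Sum>k. g (r k)) = z"
    by (rule sums_unique2[symmetric])
  moreover have "norm (\<Sum>k. g (r k)) \<le> 2 * K * norm z"
    using norm_suminf_le[OF norm_g sums_summable[OF geo]] sums_unique[OF geo] by simp
  ultimately show ?thesis by blast
qed

text \<open>
  By Baire's theorem the closure of the image of some ball contains a ball. Moved to the origin,
  this says that every point has an approximate preimage of comparable norm, and
  \<open>approx_preimage_imp_preimage\<close> turns it into an exact one.
\<close>

theorem bounded_linear_inv:
  fixes L :: "'a::banach \<Rightarrow> 'b::banach"
  assumes L: "bounded_linear L" and bij: "bij L"
  shows "bounded_linear (inv L)"
proof -
  interpret L: bounded_linear L by fact
  define A where "A n = closure (L ` cball 0 (real n))" for n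
  have cover: "(\<Union>n. A n) = UNIV"
  proof -
    have "\<exists>n. w \<in> A n" for w
    proof -
      obtain x where x: "w = L x" using bij by (metis bij_pointE)
      obtain n where "norm x \<le> real n" using real_arch_simple by blast
      then have "w \<in> L ` cball 0 (real n)" using x by simp
      then show ?thesis unfolding A_def using closure_subset by (intro exI) (rule subsetD)
    qed
    then show ?thesis by (simp add: set_eq_iff)
  qed
  have "\<exists>n. interior (A n) \<noteq> {}"
  proof (rule ccontr)
    assume no: "\<not> (\<exists>n. interior (A n) \<noteq> {})"
    have "euclidean interior_of (\<Union>(range A)) = {}"
    proof (rule Baire_category_alt)
      show "closedin euclidean B \<and> euclidean interior_of B = {}" if "B \<in> range A" for B
      proof -
        obtain n where "B = A n" using \<open>B \<in> range A\<close> by blast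
        moreover have "closed (A n)" by (simp add: A_def)
        ultimately show ?thesis using no by simp
      qed
    qed (simp_all add: completely_metrizable_space_euclidean)
    with cover show False by simp
  qed
  then obtain n a where "a \<in> interior (A n)" by blast
  then obtain \<delta> where \<delta>: "\<delta> > 0" "ball a \<delta> \<subseteq> A n"
    by (meson mem_interior)
  \<comment> \<open>Half the difference of two points of the convex symmetric set \<open>A n\<close> lies in it again, so a
    ball about \<open>a\<close> can be moved to the origin.\<close>
  have near0: "\<exists>x. norm x \<le> real n \<and> norm (z - L x) < \<epsilon>" if z: "norm z < \<delta>" and \<epsilon>: "\<epsilon> > 0" for z \<epsilon>
  proof -
    have approx_A: "\<exists>x. norm x \<le> real n \<and> norm (L x - w) < \<epsilon>" if "w \<in> A n" for w
    proof -
      have "\<exists>v\<in>L ` cball 0 (real n). dist v w < \<epsilon>"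
        using that \<epsilon> unfolding A_def closure_approachable by simp
      then show ?thesis by (simp add: dist_norm Bex_def)
    qed
    have "a + z \<in> ball a \<delta>" "a - z \<in> ball a \<delta>"
      using z by (simp_all add: dist_norm)
    then have az: "a + z \<in> A n" "a - z \<in> A n"
      using \<delta>(2) by (simp_all add: subset_iff del: mem_ball)
    obtain x1 where x1: "norm x1 \<le> real n" "norm (L x1 - (a + z)) < \<epsilon>"
      using approx_A[OF az(1)] by blast
    obtain x2 where x2: "norm x2 \<le> real n" "norm (L x2 - (a - z)) < \<epsilon>"
      using approx_A[OF az(2)] by blast
    have "norm ((1/2) *\<^sub>R (x1 - x2)) \<le> real n"
      using norm_triangle_ineq4[of x1 x2] x1 x2 by simp
    moreover have "z - L ((1/2) *\<^sub>R (x1 - x2))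
        = (1/2) *\<^sub>R ((L x2 - (a - z)) - (L x1 - (a + z)))"
    proof -
      have "(L x2 - (a - z)) - (L x1 - (a + z)) = (z + z) - (L x1 - L x2)" by simp
      then show ?thesis
        by (simp only: scaleR_diff_right[of _ "z + z"] scaleR_half_double L.scaleR L.diff)
    qed
    then have "norm (z - L ((1/2) *\<^sub>R (x1 - x2))) < \<epsilon>"
      using norm_triangle_ineq4[of "L x2 - (a - z)" "L x1 - (a + z)"] x1 x2 by simp
    ultimately show ?thesis by blast
  qed
  define K where "K = 2 * real n / \<delta>"
  have approx: "\<exists>x. norm x \<le> K * norm z \<and> norm (z - L x) \<le> norm z / 2" for z
  proof (cases "z = 0")
    case True
    then show ?thesis by (intro exI[of _ 0]) simp
  next
    case False
    \<comment> \<open>Rescale \<open>z\<close> to norm \<open>\<delta> / 2\<close>.\<close>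
    define t where "t = \<delta> / (2 * norm z)"
    have t: "t > 0" "t * norm z = \<delta> / 2" using \<delta> False by (simp_all add: t_def)
    have "norm (t *\<^sub>R z) < \<delta>" using t \<delta> by simp
    from near0[OF this, of "\<delta> / 4"] obtain x
      where x: "norm x \<le> real n" "norm (t *\<^sub>R z - L x) < \<delta> / 4" using \<delta> by auto
    have "z - L ((1/t) *\<^sub>R x) = (1/t) *\<^sub>R (t *\<^sub>R z - L x)"
      using t by (simp add: L.scaleR scaleR_diff_right)
    then have "norm (z - L ((1/t) *\<^sub>R x)) = (1/t) * norm (t *\<^sub>R z - L x)"
      using t by simp
    also have "\<dots> \<le> (1/t) * (\<delta> / 4)"
      using x t by (intro mult_left_mono) simp_all
    also have "\<dots> = norm z / 2" using \<delta> False by (simp add: t_def)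
    finally have "norm (z - L ((1/t) *\<^sub>R x)) \<le> norm z / 2" .
    moreover have "norm ((1/t) *\<^sub>R x) \<le> K * norm z"
    proof -
      have "norm ((1/t) *\<^sub>R x) \<le> (1/t) * real n"
        using x t by (simp add: divide_right_mono)
      also have "\<dots> = K * norm z" by (simp add: t_def K_def)
      finally show ?thesis .
    qed
    ultimately show ?thesis by blast
  qed
  have inv_L: "inv L (L x) = x" "L (inv L w) = w" for x w
    using bij by (simp_all add: bij_is_inj bij_is_surj surj_f_inv_f)
  show ?thesis
  proof (rule bounded_linear_intro)
    show "inv L (v + w) = inv L v + inv L w" for v w
      by (metis inv_L L.add)
    show "inv L (c *\<^sub>R w) = c *\<^sub>R inv L w" for c w
      by (metis inv_L L.scaleR)
    show "norm (inv L w) \<le> norm w * (2 * K)" for w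
      using approx_preimage_imp_preimage[OF L approx, of w] inv_L by (auto simp: mult_ac)
  qed
qed

section \<open>Geometry of the inner product\<close>

lemma sconj_0 [simp]: "sconj (0 :: 'k::rc_field) = 0"
  using sconj_add[of "0 :: 'k" 0] by simp

lemma norm_sconj [simp]: "norm (sconj (a :: 'k::rc_field)) = norm a"
proof (cases "a = 0")
  case False
  have "norm a * norm (sconj a) = norm a * norm a"
    using arg_cong[OF mult_sconj[of a], of norm] by (simp add: norm_mult power2_eq_square)
  with False show ?thesis by simp
qed simp

lemma sconj_of_real [simp]: "sconj (of_real r :: 'k::rc_field) = of_real r"
proof (cases "r = 0")
  case False
  have "(of_real r :: 'k) * sconj (of_real r) = of_real r * of_real r"
    by (simp add: mult_sconj power2_eq_square scaleR_conv_of_real)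
  with False show ?thesis by simp
qed simp

context hilbert_space
begin

lemma ip_add_right: "ip x (y + z) = ip x y + ip x z"
  by (metis ip_commute ip_add_left sconj_add)

lemma ip_smul_right: "ip x (smul a y) = sconj a * ip x y"
  by (metis ip_commute ip_smul_left sconj_mult)

lemma ip_zero_left [simp]: "ip 0 x = 0"
  using ip_add_left[of 0 0 x] by simp

lemma ip_zero_right [simp]: "ip x 0 = 0"
  using ip_add_right[of x 0 0] by simp

lemma ip_diff_left: "ip (x - y) z = ip x z - ip y z"
  using ip_add_left[of "x - y" y z] by simp

lemma ip_diff_right: "ip x (y - z) = ip x y - ip x z"
  using ip_add_right[of x "y - z" z] by simp

lemma ip_sum_right: "ip y (sum f A) = (\<Sum>i\<in>A. ip y (f i))"
  by (induction A rule: infinite_finite_induct) (simp_all add: ip_add_right)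

lemma ip_self_eq_0: "ip x x = 0 \<longleftrightarrow> x = 0"
  by (simp add: ip_norm)

lemma ip_eq_0_commute: "ip x y = 0 \<longleftrightarrow> ip y x = 0"
  by (metis ip_commute sconj_0)

lemma ip_left_cancel: "(\<And>z. ip x z = ip y z) \<Longrightarrow> x = y"
  using ip_self_eq_0[of "x - y"] by (simp add: ip_diff_left)

lemma norm_smul: "norm (smul a x) = norm a * norm x"
proof -
  have "of_real ((norm (smul a x))\<^sup>2) = (a * sconj a) * ip x x"
    unfolding ip_norm[symmetric] by (simp add: ip_smul_left ip_smul_right)
  also have "\<dots> = (of_real ((norm a * norm x)\<^sup>2) :: 'k)"
    by (simp add: mult_sconj ip_norm scaleR_conv_of_real power_mult_distrib)
  finally have "(norm (smul a x))\<^sup>2 = (norm a * norm x)\<^sup>2"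
    by (simp only: of_real_eq_iff)
  then show ?thesis by (simp add: power2_eq_iff_nonneg)
qed

lemma pythagoras:
  assumes "ip x y = 0"
  shows "(norm (x + y))\<^sup>2 = (norm x)\<^sup>2 + (norm y)\<^sup>2"
proof -
  have "ip y x = 0" using assms ip_eq_0_commute by blast
  have "of_real ((norm (x + y))\<^sup>2) = (of_real ((norm x)\<^sup>2 + (norm y)\<^sup>2) :: 'k)"
    unfolding of_real_add ip_norm[symmetric] using assms \<open>ip y x = 0\<close>
    by (simp add: ip_add_left ip_add_right)
  then show ?thesis by (simp only: of_real_eq_iff)
qed

text \<open>
  Pythagoras for the decomposition of \<open>x\<close> into its projection onto the line of \<open>y\<close> and the rest.
\<close>

lemma Cauchy_Schwarz: "norm (ip x y) \<le> norm x * norm y"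
proof (cases "y = 0")
  case False
  define t where "t = ip x y / of_real ((norm y)\<^sup>2)"
  have nt: "norm (smul t y) = norm (ip x y) / norm y"
    using False by (simp add: norm_smul t_def norm_divide norm_mult power2_eq_square)
  have "ip (x - smul t y) y = 0"
    using False by (simp add: ip_diff_left ip_smul_left ip_norm t_def)
  then have "ip (x - smul t y) (smul t y) = 0"
    by (simp add: ip_smul_right)
  from pythagoras[OF this] have "(norm (smul t y))\<^sup>2 \<le> (norm x)\<^sup>2" by simp
  then have "norm (ip x y) / norm y \<le> norm x"
    unfolding nt by (rule power2_le_imp_le) simp
  then show ?thesis using False by (simp add: divide_le_eq)
qed simp

lemma bounded_linear_ip_left: "bounded_linear (\<lambda>x. ip x z)"
proof (rule bounded_linear_intro)
  show "ip (r *\<^sub>R x) z = r *\<^sub>R ip x z" for r x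
    by (metis ip_smul_left smul_of_real scaleR_conv_of_real)
  show "norm (ip x z) \<le> norm x * norm z" for x
    by (rule Cauchy_Schwarz)
qed (rule ip_add_left)

lemma bounded_linear_ip_right: "bounded_linear (ip z)"
proof (rule bounded_linear_intro)
  show "ip z (r *\<^sub>R x) = r *\<^sub>R ip z x" for r x
    by (metis ip_smul_right smul_of_real scaleR_conv_of_real sconj_of_real)
  show "norm (ip z x) \<le> norm x * norm z" for x
    using Cauchy_Schwarz[of z x] by (simp add: mult.commute)
qed (rule ip_add_right)

end

lemma bounded_operatorD:
  assumes "hilbert_space sA ipA" "hilbert_space sB ipB" and B: "bounded_operator sA sB B"
  shows "bounded_linear B" "B (sA a x) = sB a (B x)"
proof -
  interpret A: hilbert_space sA ipA by fact
  interpret B: hilbert_space sB ipB by fact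
  obtain K where lin: "Vector_Spaces.linear sA sB B" and K: "\<And>x. norm (B x) \<le> K * norm x"
    using B unfolding bounded_operator_def by blast
  have add: "B (x + y) = B x + B y" and scale: "B (sA a x) = sB a (B x)" for a x y
    using lin unfolding Vector_Spaces.linear_iff by auto
  show "B (sA a x) = sB a (B x)" by (rule scale)
  show "bounded_linear B"
  proof (rule bounded_linear_intro)
    show "B (r *\<^sub>R x) = r *\<^sub>R B x" for r x
      by (metis scale A.smul_of_real B.smul_of_real)
    show "norm (B x) \<le> norm x * K" for x using K[of x] by (simp add: mult.commute)
  qed (rule add)
qed

section \<open>Orthonormal bases and adjoints\<close>

context hilbert_space
begin

context
  fixes e :: "nat \<Rightarrow> 'a"
  assumes ortho: "\<And>i j. ip (e i) (e j) = (if i = j then 1 else 0)"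
begin

lemma norm_orthonormal: "norm (e i) = 1"
proof -
  have "of_real ((norm (e i))\<^sup>2) = (of_real 1 :: 'k)"
    unfolding ip_norm[symmetric] by (simp add: ortho)
  then have "(norm (e i))\<^sup>2 = 1\<^sup>2" by (simp only: of_real_eq_iff one_power2)
  then show ?thesis by (rule power2_eq_imp_eq) simp_all
qed

lemma norm_sum_orthonormal:
  "finite A \<Longrightarrow> (norm (\<Sum>i\<in>A. smul (c i) (e i)))\<^sup>2 = (\<Sum>i\<in>A. (norm (c i))\<^sup>2)"
proof (induction A rule: finite_induct)
  case (insert k A)
  have "ip (smul (c k) (e k)) (\<Sum>i\<in>A. smul (c i) (e i)) = 0"
    unfolding ip_sum_right
    using insert.hyps by (intro sum.neutral) (auto simp: ip_smul_left ip_smul_right ortho)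
  from pythagoras[OF this] insert show ?case
    by (simp add: norm_smul norm_orthonormal)
qed simp

text \<open>
  By Pythagoras the squared norms of the blocks of the series are blocks of \<open>\<Sum>i. (norm (c i))\<^sup>2\<close>,
  so the Cauchy criterion transfers.
\<close>

lemma summable_orthonormal:
  assumes "summable (\<lambda>i. (norm (c i))\<^sup>2)"
  shows "summable (\<lambda>i. smul (c i) (e i))"
  unfolding summable_Cauchy
proof (intro allI impI)
  fix \<epsilon> :: real assume "\<epsilon> > 0"
  then have "\<epsilon>\<^sup>2 > 0" by simp
  then obtain N where N: "\<And>m n. m \<ge> N \<Longrightarrow> norm (\<Sum>i\<in>{m..<n}. (norm (c i))\<^sup>2) < \<epsilon>\<^sup>2"
    using assms unfolding summable_Cauchy by blast
  have "norm (\<Sum>i\<in>{m..<n}. smul (c i) (e i)) < \<epsilon>" if "m \<ge> N" for m n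
  proof (rule power2_less_imp_less)
    show "(norm (\<Sum>i\<in>{m..<n}. smul (c i) (e i)))\<^sup>2 < \<epsilon>\<^sup>2"
      using N[OF that, of n] by (simp add: norm_sum_orthonormal abs_of_nonneg sum_nonneg)
  qed (use \<open>\<epsilon> > 0\<close> in simp)
  then show "\<exists>N. \<forall>m\<ge>N. \<forall>n. norm (\<Sum>i\<in>{m..<n}. smul (c i) (e i)) < \<epsilon>" by blast
qed

text \<open>
  Bessel's inequality for the functional \<open>z \<mapsto> ip (B z) x\<close>: testing it on the partial sum
  with coefficients \<open>ip x (B (e i))\<close> gives \<open>s \<le> K * norm x * sqrt s\<close> for the partial sums \<open>s\<close>
  of the squares.
\<close>

lemma square_summable_coefficients:
  assumes B: "bounded_linear B" and scale: "\<And>a z. B (smul a z) = smul a (B z)"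
  shows "summable (\<lambda>i. (norm (ip x (B (e i))))\<^sup>2)"
proof -
  interpret B: bounded_linear B by fact
  obtain K where K: "\<And>z. norm (B z) \<le> norm z * K" and "K \<ge> 0"
    using B.nonneg_bounded by blast
  define c where "c i = ip x (B (e i))" for i
  have "(\<Sum>i<n. (norm (c i))\<^sup>2) \<le> (norm x * K)\<^sup>2" for n
  proof -
    define s where "s = (\<Sum>i<n. (norm (c i))\<^sup>2)"
    define v where "v = (\<Sum>i<n. smul (c i) (e i))"
    have "s \<ge> 0" by (simp add: s_def sum_nonneg)
    have v: "(norm v)\<^sup>2 = s" unfolding v_def s_def by (rule norm_sum_orthonormal) simp
    have "ip x (B v) = (\<Sum>i<n. c i * sconj (c i))"
      unfolding v_def B.sum scale ip_sum_right ip_smul_right by (simp add: c_def mult.commute)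
    also have "\<dots> = of_real s"
      by (simp add: mult_sconj s_def scaleR_conv_of_real)
    finally have "s = norm (ip x (B v))" using \<open>s \<ge> 0\<close> by simp
    also have "\<dots> \<le> norm x * norm (B v)" by (rule Cauchy_Schwarz)
    also have "\<dots> \<le> norm x * (norm v * K)"
      by (intro mult_left_mono K) simp
    finally have "norm v * norm v \<le> norm x * K * norm v"
      using v by (simp add: power2_eq_square mult_ac)
    then have "norm v \<le> norm x * K"
      using \<open>K \<ge> 0\<close> by (cases "v = 0") auto
    then show ?thesis using v power_mono[of "norm v" "norm x * K" 2] by (simp add: s_def)
  qed
  then show ?thesis unfolding c_def[symmetric] by (intro summableI_nonneg_bounded) auto
qed

end

lemma orthogonal_span:
  assumes "\<And>b. b \<in> A \<Longrightarrow> ip w b = 0" and "z \<in> span A"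
  shows "ip w z = 0"
  using assms(2)
proof (induction rule: span_induct_alt)
  case (step a b z)
  then show ?case using assms(1)[of b] by (simp add: ip_add_right ip_smul_right)
qed simp

text \<open>
  The orthogonal complement of \<open>w\<close> is a closed subspace, so it contains the closed span of the
  basis and therefore \<open>w\<close> itself.
\<close>

lemma orthogonal_basis_imp_0:
  assumes e: "orthonormal_basis smul ip e" and w: "\<And>i. ip w (e i) = 0"
  shows "w = 0"
proof -
  have "range e \<subseteq> {z. ip w z = 0}" using w by blast
  then have "span (range e) \<subseteq> {z. ip w z = 0}"
    using orthogonal_span[of "range e" w] w by blast
  moreover have "closed {z. ip w z = 0}"
    by (intro closed_Collect_eq linear_continuous_on bounded_linear_ip_right continuous_on_const)
  ultimately have "closure (span (range e)) \<subseteq> {z. ip w z = 0}"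
    by (rule closure_minimal)
  then have "ip w w = 0" using e unfolding orthonormal_basis_def by blast
  then show ?thesis by (simp add: ip_self_eq_0)
qed

lemma ip_sums: "f sums s \<Longrightarrow> (\<lambda>i. ip (f i) z) sums ip s z"
  by (rule bounded_linear.sums[OF bounded_linear_ip_left])

text \<open>
  The Fourier series converges by Bessel's inequality, and its sum has the same coefficients as
  \<open>x\<close>; their difference is orthogonal to the basis.
\<close>

lemma orthonormal_basis_expansion:
  assumes e: "orthonormal_basis smul ip e"
  shows "(\<lambda>i. smul (ip x (e i)) (e i)) sums x"
proof -
  have ortho: "ip (e i) (e j) = (if i = j then 1 else 0)" for i j
    using e by (simp add: orthonormal_basis_def)
  define g where "g = (\<Sum>i. smul (ip x (e i)) (e i))"
  have "summable (\<lambda>i. (norm (ip x (e i)))\<^sup>2)"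
    using square_summable_coefficients[OF ortho, of "\<lambda>z. z"] by simp
  then have g: "(\<lambda>i. smul (ip x (e i)) (e i)) sums g"
    unfolding g_def by (intro summable_sums summable_orthonormal[OF ortho])
  have "ip (x - g) (e j) = 0" for j
  proof -
    have "(\<lambda>i. if i = j then ip x (e i) else 0) sums ip g (e j)"
      using ip_sums[OF g, of "e j"] by (simp add: ip_smul_left ortho if_distrib cong: if_cong)
    then have "ip g (e j) = ip x (e j)"
      by (rule sums_unique2[OF _ sums_single])
    then show ?thesis by (simp add: ip_diff_left)
  qed
  from orthogonal_basis_imp_0[OF e this] g show ?thesis by simp
qed

text \<open>
  The orthonormal basis stands in for the Riesz representation theorem: the adjoint at \<open>x\<close> is
  the sum of the series with coefficients \<open>ip x (B (e i))\<close>.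
\<close>

lemma adjoint_exists:
  assumes e: "orthonormal_basis smul ip e"
    and B: "bounded_linear B" and scale: "\<And>a z. B (smul a z) = smul a (B z)"
  obtains B' where "\<And>x z. ip (B' x) z = ip x (B z)"
proof -
  have ortho: "ip (e i) (e j) = (if i = j then 1 else 0)" for i j
    using e by (simp add: orthonormal_basis_def)
  interpret B: bounded_linear B by fact
  define B' where "B' x = (\<Sum>i. smul (ip x (B (e i))) (e i))" for x
  have "ip (B' x) z = ip x (B z)" for x z
  proof -
    have "(\<lambda>i. smul (ip x (B (e i))) (e i)) sums B' x"
      unfolding B'_def
      by (intro summable_sums summable_orthonormal[OF ortho] square_summable_coefficients[OF ortho B scale])
    from ip_sums[OF this, of z]
    have "(\<lambda>i. ip x (B (e i)) * ip (e i) z) sums ip (B' x) z"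
      by (simp add: ip_smul_left)
    moreover have "(\<lambda>i. ip x (B (smul (ip z (e i)) (e i)))) sums ip x (B z)"
      by (intro bounded_linear.sums[OF bounded_linear_ip_right] B.sums orthonormal_basis_expansion e)
    then have "(\<lambda>i. ip x (B (e i)) * ip (e i) z) sums ip x (B z)"
      by (simp add: scale ip_smul_right ip_commute[of _ z] mult.commute)
    ultimately show ?thesis by (rule sums_unique2)
  qed
  then show ?thesis by (rule that)
qed

section \<open>Riesz bases\<close>

text \<open>
  With \<open>f i = L (e i)\<close>, \<open>M = inv L\<close> and adjoints \<open>L'\<close>, \<open>M'\<close>, the frame operator is \<open>L L'\<close> with
  inverse \<open>M' M\<close>. Hence the claimed expansion of \<open>x\<close> is the image under \<open>L\<close> of the Fourier
  expansion of \<open>M x\<close>.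
\<close>

lemma riesz_basis_reconstruction:
  assumes "riesz_basis smul ip f"
  shows "(\<lambda>i. smul (ip x (inv (frame_operator smul ip f) (f i))) (f i)) sums x"
proof -
  obtain e L where e: "orthonormal_basis smul ip e" and L: "bounded_operator smul smul L"
    and bij: "bij L" and f: "\<And>i. f i = L (e i)"
    using assms unfolding riesz_basis_def by blast
  note H = hilbert_space_axioms
  have lin: "bounded_linear L" and scale: "L (smul a z) = smul a (L z)" for a z
    using bounded_operatorD[OF H H L] by blast+
  interpret L: bounded_linear L by (rule lin)
  define M where "M = inv L"
  have M_L: "M (L z) = z" and L_M: "L (M z) = z" for z
    using bij by (simp_all add: M_def bij_is_inj bij_is_surj surj_f_inv_f)
  have M: "bounded_linear M" unfolding M_def by (rule bounded_linear_inv[OF lin bij])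
  have scale_M: "M (smul a z) = smul a (M z)" for a z
    by (metis M_L L_M scale)
  obtain L' where L': "\<And>x z. ip (L' x) z = ip x (L z)"
    by (rule adjoint_exists[OF e lin scale]) blast
  obtain M' where M': "\<And>x z. ip (M' x) z = ip x (M z)"
    by (rule adjoint_exists[OF e M scale_M]) blast
  have L'_M': "L' (M' z) = z" and M'_L': "M' (L' z) = z" for z
    by (rule ip_left_cancel, simp add: L' M' M_L L_M)+
  let ?S = "frame_operator smul ip f"
  have S: "?S z = L (L' z)" for z
  proof -
    have "(\<lambda>i. L (smul (ip (L' z) (e i)) (e i))) sums L (L' z)"
      by (intro L.sums orthonormal_basis_expansion e)
    then have "(\<lambda>i. smul (ip z (f i)) (f i)) sums L (L' z)"
      by (simp add: scale L' f)
    then show ?thesis unfolding frame_operator_def by (rule sums_unique[symmetric])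
  qed
  have "inj ?S"
    by (rule inj_on_inverseI[of _ "\<lambda>w. M' (M w)"]) (simp add: S M_L M'_L')
  have inv_S: "inv ?S (L (e i)) = M' (e i)" for i
  proof (rule inv_f_eq[OF \<open>inj ?S\<close>])
    show "?S (M' (e i)) = L (e i)" by (simp add: S L'_M')
  qed
  have coeff: "ip x (M' (e i)) = ip (M x) (e i)" for i
    using M'[of "e i" x] ip_commute[of x "M' (e i)"] ip_commute[of "M x" "e i"] by simp
  have "(\<lambda>i. L (smul (ip (M x) (e i)) (e i))) sums L (M x)"
    by (intro L.sums orthonormal_basis_expansion e)
  then show ?thesis by (simp add: inv_S coeff scale L_M f)
qed

text \<open>
  Synthesis with \<open>f i = L (e i)\<close> is synthesis with \<open>e\<close>, which is isometric on square-summable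
  coefficients, followed by \<open>L\<close>; so a bound for \<open>L\<close> serves as \<open>B\<close>.
\<close>

lemma riesz_basis_upper_bound:
  assumes "riesz_basis smul ip f"
  obtains B where "B \<ge> 0"
    and "\<And>c s. (\<lambda>j. smul (c j) (f j)) sums s \<Longrightarrow> summable (\<lambda>j. (norm (c j))\<^sup>2)
           \<Longrightarrow> norm s \<le> B * sqrt (\<Sum>j. (norm (c j))\<^sup>2)"
proof -
  obtain e L where e: "orthonormal_basis smul ip e" and L: "bounded_operator smul smul L"
    and f: "f = (\<lambda>i. L (e i))"
    using assms unfolding riesz_basis_def by blast
  have ortho: "ip (e i) (e j) = (if i = j then 1 else 0)" for i j
    using e by (simp add: orthonormal_basis_def)
  note H = hilbert_space_axioms
  have lin: "bounded_linear L" and scale: "L (smul a z) = smul a (L z)" for a z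
    using bounded_operatorD[OF H H L] by blast+
  interpret L: bounded_linear L by (rule lin)
  obtain B where B: "\<And>z. norm (L z) \<le> norm z * B" "B \<ge> 0"
    using L.nonneg_bounded by blast
  show ?thesis
  proof (rule that[OF \<open>B \<ge> 0\<close>])
    fix c s assume s: "(\<lambda>j. smul (c j) (f j)) sums s" and c: "summable (\<lambda>j. (norm (c j))\<^sup>2)"
    have "norm (\<Sum>j<n. smul (c j) (f j)) \<le> B * sqrt (\<Sum>j. (norm (c j))\<^sup>2)" for n
    proof -
      define v where "v = (\<Sum>j<n. smul (c j) (e j))"
      have "(norm v)\<^sup>2 = (\<Sum>j<n. (norm (c j))\<^sup>2)"
        unfolding v_def by (rule norm_sum_orthonormal[OF ortho]) simp
      also have "\<dots> \<le> (\<Sum>j. (norm (c j))\<^sup>2)"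
        by (rule sum_le_suminf[OF c]) auto
      finally have v: "norm v \<le> sqrt (\<Sum>j. (norm (c j))\<^sup>2)" by (rule real_le_rsqrt)
      have "(\<Sum>j<n. smul (c j) (f j)) = L v"
        by (simp add: v_def L.sum scale f)
      then have "norm (\<Sum>j<n. smul (c j) (f j)) \<le> B * norm v"
        using B(1)[of v] by (simp add: mult.commute)
      also have "\<dots> \<le> B * sqrt (\<Sum>j. (norm (c j))\<^sup>2)"
        by (intro mult_left_mono v \<open>B \<ge> 0\<close>)
      finally show ?thesis .
    qed
    with s show "norm s \<le> B * sqrt (\<Sum>j. (norm (c j))\<^sup>2)"
      unfolding sums_def by (intro LIMSEQ_le_const2[OF tendsto_norm]) auto
  qed
qed

section \<open>Orthogonal projections onto finite-dimensional subspaces\<close>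

lemma finite_span_projection_exists:
  assumes "finite A"
  shows "\<exists>p\<in>span A. \<forall>v\<in>span A. ip (x - p) v = 0"
  using assms
proof (induction A arbitrary: x rule: finite_induct)
  case empty
  show ?case by simp
next
  case (insert b A)
  \<comment> \<open>Gram--Schmidt: \<open>q\<close> is the component of the new vector orthogonal to the old span.\<close>
  obtain p where p: "p \<in> span A" "\<And>v. v \<in> span A \<Longrightarrow> ip (b - p) v = 0"
    using insert.IH by blast
  define q where "q = b - p"
  obtain r where r: "r \<in> span A" "\<And>v. v \<in> span A \<Longrightarrow> ip (x - r) v = 0"
    using insert.IH by blast
  \<comment> \<open>If \<open>q = 0\<close> the coefficient is \<open>0\<close> by the convention for division by zero, as it should be.\<close>
  define t where "t = ip x q / ip q q"
  have sub: "v \<in> span (insert b A)" if "v \<in> span A" for v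
    using that span_mono[of A "insert b A"] by blast
  have "r + smul t q \<in> span (insert b A)"
    unfolding q_def by (intro span_add span_scale span_diff sub p r span_base) simp
  moreover have "ip (x - (r + smul t q)) v = 0" if "v \<in> span (insert b A)" for v
  proof (rule orthogonal_span[OF _ that])
    fix a assume "a \<in> insert b A"
    have orth_A: "ip (x - (r + smul t q)) w = 0" if "w \<in> span A" for w
      using p(2)[OF that] r(2)[OF that]
      by (simp add: ip_diff_left ip_add_left ip_smul_left q_def)
    have "ip q r = 0" unfolding q_def using p(2) r(1) by blast
    then have "ip r q = 0" using ip_eq_0_commute by blast
    have "ip (x - (r + smul t q)) q = 0"
    proof (cases "q = 0")
      case False
      then have "ip q q \<noteq> 0" by (simp add: ip_self_eq_0)
      then show ?thesis
        using \<open>ip r q = 0\<close> by (simp add: ip_diff_left ip_add_left ip_smul_left t_def)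
    qed simp
    then have "ip (x - (r + smul t q)) b = 0"
      using orth_A[OF p(1)] by (simp add: q_def ip_diff_right)
    then show "ip (x - (r + smul t q)) a = 0"
      using \<open>a \<in> insert b A\<close> orth_A span_base by blast
  qed
  ultimately show ?case by blast
qed

context
  fixes A :: "'a set"
  assumes fin: "finite A"
begin

lemma orth_proj_eqI:
  assumes "p \<in> span A" "\<And>v. v \<in> span A \<Longrightarrow> ip (x - p) v = 0"
  shows "orth_proj ip (span A) x = p"
  unfolding orth_proj_def
proof (rule the_equality)
  fix p' assume p': "p' \<in> span A \<and> (\<forall>v\<in>span A. ip (x - p') v = 0)"
  then have "p' - p \<in> span A" using assms span_diff by blast
  then have "ip (x - p) (p' - p) = 0" "ip (x - p') (p' - p) = 0" using assms p' by blast+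
  then have "ip (p' - p) (p' - p) = 0" by (simp add: ip_diff_left)
  then show "p' = p" by (simp add: ip_self_eq_0)
qed (use assms in blast)

lemma
  shows orth_proj_in_span: "orth_proj ip (span A) x \<in> span A"
    and orth_proj_orthogonal: "v \<in> span A \<Longrightarrow> ip (x - orth_proj ip (span A) x) v = 0"
proof -
  obtain p where p: "p \<in> span A" "\<And>v. v \<in> span A \<Longrightarrow> ip (x - p) v = 0"
    using finite_span_projection_exists[OF fin] by blast
  from orth_proj_eqI[OF this] p
  show "orth_proj ip (span A) x \<in> span A"
    and "v \<in> span A \<Longrightarrow> ip (x - orth_proj ip (span A) x) v = 0"
    by simp_all
qed

lemma orth_proj_fixes: "x \<in> span A \<Longrightarrow> orth_proj ip (span A) x = x"
  by (rule orth_proj_eqI) simp_all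

lemma orth_proj_smul:
  "orth_proj ip (span A) (smul a x) = smul a (orth_proj ip (span A) x)"
  by (intro orth_proj_eqI span_scale orth_proj_in_span)
    (simp add: ip_smul_left orth_proj_orthogonal flip: scale_right_diff_distrib)

lemma bounded_linear_orth_proj: "bounded_linear (orth_proj ip (span A))"
proof (rule bounded_linear_intro)
  let ?P = "orth_proj ip (span A)"
  show "?P (x + z) = ?P x + ?P z" for x z
    by (intro orth_proj_eqI span_add orth_proj_in_span)
      (simp add: add_diff_add ip_add_left orth_proj_orthogonal)
  show "?P (r *\<^sub>R x) = r *\<^sub>R ?P x" for r x
    by (metis orth_proj_smul smul_of_real)
  \<comment> \<open>Pythagoras for \<open>x = (x - ?P x) + ?P x\<close>.\<close>
  show "norm (?P x) \<le> norm x * 1" for x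
  proof -
    have "ip (x - ?P x) (?P x) = 0" by (intro orth_proj_orthogonal orth_proj_in_span)
    from pythagoras[OF this] have "(norm (?P x))\<^sup>2 \<le> (norm x)\<^sup>2" by simp
    from power2_le_imp_le[OF this norm_ge_zero] show ?thesis by simp
  qed
qed

end

end

section \<open>Weak convergence of the projected solutions\<close>

theorem theorem4p5:
  fixes scaleU :: "'k::rc_field \<Rightarrow> 'u::banach \<Rightarrow> 'u"
    and ipU :: "'u \<Rightarrow> 'u \<Rightarrow> 'k"
    and scaleY :: "'k \<Rightarrow> 'y::banach \<Rightarrow> 'y"
    and ipY :: "'y \<Rightarrow> 'y \<Rightarrow> 'k"
    and T :: "'u \<Rightarrow> 'y"
    and S :: "'u \<Rightarrow> 'u"
    and u :: "nat \<Rightarrow> 'u"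
    and y :: "nat \<Rightarrow> 'y"
    and Y :: "nat \<Rightarrow> 'y set"
    and P :: "nat \<Rightarrow> 'y \<Rightarrow> 'y"
    and u_dag :: 'u
    and y_dag :: 'y
    and c :: "nat \<Rightarrow> nat \<Rightarrow> nat \<Rightarrow> 'k"
    and C :: real
  assumes U: "hilbert_space scaleU ipU"
    and Y: "hilbert_space scaleY ipY"
    and T: "bounded_operator scaleU scaleY T" "inj T"
    and u: "riesz_basis scaleU ipU u"
    and S: "S = frame_operator scaleU ipU u"
    and y: "\<And>i. y i = T (u i)"
    and Y_n: "\<And>n. Y n = module.span scaleY (y ` {..n})"
    and P: "\<And>n. P n = orth_proj ipY (Y n)"
    and y_dag: "y_dag = T u_dag"
    and c: "\<And>i n. (\<lambda>j. scaleU (c i n j) (u j)) sums inv T (P n (y i))"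
    and l1: "summable (\<lambda>i. norm (ipU u_dag (inv S (u i))))"
    and C: "\<And>i n. summable (\<lambda>j. (norm (c i n j))\<^sup>2) \<and> (\<Sum>j. (norm (c i n j))\<^sup>2) < C"
  shows "(\<forall>n. (\<lambda>i. scaleU (ipU u_dag (inv S (u i))) (inv T (P n (y i))))
              sums inv T (P n y_dag)) \<and>
         weakly_converges_to ipU (\<lambda>n. inv T (P n y_dag)) u_dag"
proof -
  interpret U: hilbert_space scaleU ipU by fact
  interpret Y: hilbert_space scaleY ipY by fact
  have T_lin: "bounded_linear T" and T_scale: "T (scaleU a x) = scaleY a (T x)" for a x
    using bounded_operatorD[OF U Y T(1)] by blast+
  interpret T: bounded_linear T by (rule T_lin)
  define a where "a i = ipU u_dag (inv S (u i))" for i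
  define t where "t n i = inv T (P n (y i))" for n i
  define w where "w = (\<lambda>n. inv T (P n y_dag))"

  have u_dag: "(\<lambda>i. scaleU (a i) (u i)) sums u_dag"
    using U.riesz_basis_reconstruction[OF u] by (simp add: a_def S)
  have l1: "summable (\<lambda>i. norm (a i))" using l1 by (simp add: a_def)

  obtain M where M: "\<And>n i. norm (t n i) \<le> M"
  proof -
    obtain B where B: "B \<ge> 0" "\<And>c s. (\<lambda>j. scaleU (c j) (u j)) sums s
        \<Longrightarrow> summable (\<lambda>j. (norm (c j))\<^sup>2) \<Longrightarrow> norm s \<le> B * sqrt (\<Sum>j. (norm (c j))\<^sup>2)"
      using U.riesz_basis_upper_bound[OF u] by blast
    have "norm (t n i) \<le> B * sqrt C" for n i
    proof -
      have "norm (t n i) \<le> B * sqrt (\<Sum>j. (norm (c i n j))\<^sup>2)"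
        unfolding t_def using c C by (intro B(2)) auto
      also have "\<dots> \<le> B * sqrt C"
        using C[of i n] B(1) by (intro mult_left_mono real_sqrt_le_mono) auto
      finally show ?thesis .
    qed
    then show ?thesis by (rule that)
  qed

  have P_lin: "bounded_linear (P n)" and P_scale: "P n (scaleY b x) = scaleY b (P n x)"
    and P_in: "P n x \<in> Y n" and P_fix: "x \<in> Y n \<Longrightarrow> P n x = x" for n b x
    unfolding P Y_n
    by (simp_all add: Y.bounded_linear_orth_proj Y.orth_proj_smul Y.orth_proj_in_span
        Y.orth_proj_fixes)
  have y_in: "y i \<in> Y n" if "i \<le> n" for i n
    using that unfolding Y_n by (intro Y.span_base) simp
  \<comment> \<open>On the range of \<open>T\<close> the total function \<open>inv T\<close> is a genuine inverse.\<close>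
  have Y_range: "z \<in> range T" if "z \<in> Y n" for z n
    using that unfolding Y_n
  proof (induction rule: Y.span_induct_alt)
    case base
    show ?case using T.zero by (metis rangeI)
  next
    case (step b x z)
    then obtain i z' where "x = T (u i)" "z = T z'" using y by blast
    then have "scaleY b x + z = T (scaleU b (u i) + z')"
      by (simp add: T.add T_scale)
    then show ?case by simp
  qed
  have T_t: "T (t n i) = P n (y i)" for n i
    unfolding t_def by (rule f_inv_into_f[OF Y_range[OF P_in]])
  have t_fix: "t n i = u i" if "i \<le> n" for n i
    unfolding t_def using P_fix[OF y_in[OF that]] y T(2) by simp
  \<comment> \<open>\<open>u i\<close> is itself one of the \<open>t n i\<close>, so it obeys the same bound.\<close>
  have norm_u: "norm (u i) \<le> M" for i
    using M[of i i] by (simp add: t_fix)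

  \<comment> \<open>The sum is found first in the domain of \<open>T\<close>, where absolute convergence is available,
    and then recognised by applying the bounded operator \<open>T\<close> to it.\<close>
  have w_sums: "(\<lambda>i. scaleU (a i) (t n i)) sums w n" for n
  proof -
    have "summable (\<lambda>i. scaleU (a i) (t n i))"
    proof (rule summable_comparison_test'[OF summable_mult2[OF l1, of M], of 0])
      show "norm (scaleU (a i) (t n i)) \<le> norm (a i) * M" for i
        unfolding U.norm_smul by (intro mult_left_mono M) simp
    qed
    then have w': "(\<lambda>i. scaleU (a i) (t n i)) sums (\<Sum>i. scaleU (a i) (t n i))"
      by (rule summable_sums)
    from T.sums[OF this]
    have "(\<lambda>i. scaleY (a i) (P n (y i))) sums T (\<Sum>i. scaleU (a i) (t n i))"
      by (simp add: T_scale T_t)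
    moreover have "(\<lambda>i. P n (T (scaleU (a i) (u i)))) sums P n y_dag"
      unfolding y_dag by (intro bounded_linear.sums[OF P_lin] T.sums u_dag)
    then have "(\<lambda>i. scaleY (a i) (P n (y i))) sums P n y_dag"
      by (simp add: T_scale P_scale y)
    ultimately have "P n y_dag = T (\<Sum>i. scaleU (a i) (t n i))"
      by (rule sums_unique2[symmetric])
    then have "w n = (\<Sum>i. scaleU (a i) (t n i))"
      unfolding w_def using T(2) by simp
    with w' show ?thesis by simp
  qed

  \<comment> \<open>Only indices above \<open>n\<close> contribute, by \<open>t_fix\<close>.\<close>
  have error: "norm (w n - u_dag) \<le> (\<Sum>i. norm (a (i + Suc n))) * (2 * M)" for n
  proof -
    have "(\<lambda>i. scaleU (a i) (t n i - u i)) sums (w n - u_dag)"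
      using sums_diff[OF w_sums u_dag] by (simp add: U.scale_right_diff_distrib)
    from sums_split_initial_segment[OF this, of "Suc n"]
    have d: "(\<lambda>i. scaleU (a (i + Suc n)) (t n (i + Suc n) - u (i + Suc n))) sums (w n - u_dag)"
      by (simp add: t_fix)
    have tail: "summable (\<lambda>i. norm (a (i + Suc n)))"
      using l1 by (subst summable_iff_shift)
    have "norm (w n - u_dag) \<le> (\<Sum>i. norm (a (i + Suc n)) * (2 * M))"
      unfolding sums_unique[OF d]
    proof (rule norm_suminf_le)
      show "norm (scaleU (a (i + Suc n)) (t n (i + Suc n) - u (i + Suc n)))
          \<le> norm (a (i + Suc n)) * (2 * M)" for i
      proof -
        have "norm (t n (i + Suc n) - u (i + Suc n)) \<le> 2 * M"
          using norm_triangle_ineq4[of "t n (i + Suc n)" "u (i + Suc n)"]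
            M[of n "i + Suc n"] norm_u[of "i + Suc n"] by linarith
        then show ?thesis unfolding U.norm_smul by (rule mult_left_mono) simp
      qed
      show "summable (\<lambda>i. norm (a (i + Suc n)) * (2 * M))"
        by (rule summable_mult2[OF tail])
    qed
    also have "\<dots> = (\<Sum>i. norm (a (i + Suc n))) * (2 * M)"
      by (rule suminf_mult2[OF tail, symmetric])
    finally show ?thesis .
  qed
  have "(\<lambda>n. \<Sum>i. norm (a (i + n))) \<longlonglongrightarrow> 0"
    unfolding suminf_minus_initial_segment[OF l1]
    using tendsto_diff[OF tendsto_const[of "\<Sum>i. norm (a i)"] summable_LIMSEQ[OF l1]] by simp
  from LIMSEQ_Suc[OF this] have "(\<lambda>n. (\<Sum>i. norm (a (i + Suc n))) * (2 * M)) \<longlonglongrightarrow> 0"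
    by (rule tendsto_mult_left_zero)
  then have "(\<lambda>n. w n - u_dag) \<longlonglongrightarrow> 0"
    by (rule Lim_null_comparison[OF always_eventually, OF allI, OF error])
  then have "w \<longlonglongrightarrow> u_dag" by (rule Lim_null[THEN iffD2])
  then have "weakly_converges_to ipU w u_dag"
    unfolding weakly_converges_to_def
    by (intro allI bounded_linear.tendsto[OF U.bounded_linear_ip_left])
  with w_sums show ?thesis unfolding a_def t_def w_def by (intro conjI allI)
qed

end
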